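(* Let $p,q\geq3$ be odd and relatively prime, and let $(a,b)$ be an admissible pair of cyclic steps. Then the Elford--Lisoněk configuration associated with $p$ and $q$ (built from $(a,b)$) is orthogonally equivalent, up to reindexing, to the dual-grid configuration $Z_{p,q}=Z_{p,q}(a,b)$. Under this equivalence, the two cyclic orbits $\{[M^t a_{\mathrm{EL}}]\}_{t}$ and $\{[M^t b_{\mathrm{EL}}]\}_t$ become the two $(p,q)$-grids $A\subset Q_c$ and $B\subset Q_c^{\perp_h}$, respectively, and the distinguished orthogonal bases $E_t$ become the contexts $C_{ij}$.
   Context: Let $V=\mathbb R^4=\mathbb R^2\oplus\mathbb R^2$ with the standard Euclidean inner product $h$. Rays are points of $\mathbb P^3(\mathbb R)=\mathbb P(V)$. Two sets of rays are orthogonally equivalent if some element of $O(4)$ maps one onto the other. Dual-grid configuration: let $p,q\ge3$ be odd, $a\in\mathbb Z_p^\times$, $b\in\mathbb Z_q^\times$ (with $\mathbb Z_m=\mathbb Z/m\mathbb Z$), $\alpha=2\pi a/p$, $\beta=2\pi b/q$, $u(\theta)=(\cos\theta,\sin\theta)$. The pair $(a,b)$ is admissible if $-\cos(\alpha-\beta)/\cos(\alpha+\beta)$ is positive, finite and different from $1$; then $c>0$ is defined by $c^2=-\cos(\alpha-\beta)/\cos(\alpha+\beta)$. For $(i,j)\in\mathbb Z_p\times\mathbb Z_q$ put $A_{ij}=[u(i\alpha-j\beta),-c\,u(i\alpha+j\beta)]$, $B_{ij}=[c\,u(i\alpha-j\beta),u(i\alpha+j\beta)]$, $A=\{A_{ij}\}$,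 $B=\{B_{ij}\}$, $Z_{p,q}(a,b)=A\sqcup B$, and $C_{ij}=\{A_{ij},A_{i-1,j-1},B_{i,j-1},B_{i-1,j}\}$. With coordinates $(u_1,u_2,v_1,v_2)$ on $\mathbb R^2\oplus\mathbb R^2$, $Q_c$ is the quadric $c^2(u_1^2+u_2^2)-(v_1^2+v_2^2)=0$ and $Q_c^{\perp_h}$ is its Euclidean dual $(u_1^2+u_2^2)-c^2(v_1^2+v_2^2)=0$. A $(p,q)$-grid on a smooth split quadric is the set of $pq$ intersection points of $p$ lines of one ruling with $q$ lines of the other. Elford--Lisoněk configuration: assume $\gcd(p,q)=1$ and put $d=pq$. With $\alpha=2\pi a/p$, $\beta=2\pi b/q$, $c>0$ defined by $c^2=-\cos(\alpha-\beta)/\cos(\alpha+\beta)$, and $R_\theta=\begin{pmatrix}\cos\theta&-\sin\theta\\ \sin\theta&\cos\theta\end{pmatrix}$, let $M=R_\alpha\otimes R_\beta$ (Kronecker product, acting on $\mathbb R^4$ with coordinates $(x_{11},x_{12},x_{21},x_{22})$), and $$a_{\mathrm{EL}}=\bigl((1-c)\cos\beta,\ (1-c)\sin\beta,\ -(1+c)\sin\beta,\ (1+c)\cos\beta\bigr)^t,\qquad b_{\mathrm{EL}}=(c+1,\,0,\,0,\,c-1)^t.$$ The configuration consists of the rays spanned by $M^ta_{\mathrm{EL}}$ and $M^tb_{\mathrm{EL}}$, $t\in\mathbb Z_d$. Let $r\in\mathbb Z_d$ be determined by $r\equiv1\pmod p$ and $r\equiv-1\pmod q$. Its distinguished orthogonal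 bases are (the sets of rays spanned by) $$E_t=\{M^ta_{\mathrm{EL}},\ M^{t-1}a_{\mathrm{EL}},\ M^tb_{\mathrm{EL}},\ M^{t-r}b_{\mathrm{EL}}\},\qquad t\in\mathbb Z_d .$$ *)

theory Defs
  imports "HOL-Analysis.Analysis" "HOL-Number_Theory.Cong"
begin

section \<open>Rays, lines, quadrics and grids in real projective 3-space\<close>

text \<open>
  Points and lines of the projective space of \<open>V = real^4\<close> are the linear subspaces of dimension 1
  and 2, and a quadric is represented by its cone of zeros in \<open>V\<close>. Hence incidence is inclusion,
  and two lines are disjoint in projective space iff their intersection is \<open>{0}\<close>.
\<close>

definition is_ray :: "(real^4) set \<Rightarrow> bool" where
  "is_ray L \<longleftrightarrow> subspace L \<and> dim L = 1"

definition ray :: "real^4 \<Rightarrow> (real^4) set" where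
  "ray v = span {v}"

definition ray_image :: "real^4^4 \<Rightarrow> (real^4) set set \<Rightarrow> (real^4) set set" where
  "ray_image P S = (\<lambda>L. (\<lambda>x. P *v x) ` L) ` S"

definition orthogonally_equivalent_by ::
    "real^4^4 \<Rightarrow> (real^4) set set \<Rightarrow> (real^4) set set \<Rightarrow> bool" where
  "orthogonally_equivalent_by P S T \<longleftrightarrow> orthogonal_matrix P \<and> ray_image P S = T"

definition orthogonal_ray_basis :: "(real^4) set set \<Rightarrow> bool" where
  "orthogonal_ray_basis S \<longleftrightarrow> card S = 4 \<and> (\<forall>L\<in>S. is_ray L) \<and>
     (\<forall>L\<in>S. \<forall>L'\<in>S. L \<noteq> L' \<longrightarrow> (\<forall>x\<in>L. \<forall>y\<in>L'. orthogonal x y))"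

definition rays_on :: "(real^4) set \<Rightarrow> (real^4) set set" where
  "rays_on Q = {L. is_ray L \<and> L \<subseteq> Q}"

definition lines_on :: "(real^4) set \<Rightarrow> (real^4) set set" where
  "lines_on Q = {L. subspace L \<and> dim L = 2 \<and> L \<subseteq> Q}"

text \<open>
  A quadric is smooth if it is the zero set of a nondegenerate quadratic form; in projective
  3-space a smooth quadric is split (signature (2,2)) iff it contains a real line.
\<close>

definition smooth_split_quadric :: "(real^4) set \<Rightarrow> bool" where
  "smooth_split_quadric Q \<longleftrightarrow>
     (\<exists>G::real^4^4. transpose G = G \<and> invertible G \<and> Q = {x. x \<bullet> (G *v x) = 0}) \<and>
     lines_on Q \<noteq> {}"

text \<open>
  On a smooth split quadric, two lines belong to the same ruling iff they are equal or disjoint;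
  this relation has exactly two classes, the two rulings.
\<close>

definition same_ruling :: "(real^4) set \<Rightarrow> ((real^4) set \<times> (real^4) set) set" where
  "same_ruling Q = {(L, L'). L \<in> lines_on Q \<and> L' \<in> lines_on Q \<and> (L = L' \<or> L \<inter> L' = {0})}"

definition rulings :: "(real^4) set \<Rightarrow> (real^4) set set set" where
  "rulings Q = lines_on Q // same_ruling Q"

definition is_grid :: "nat \<Rightarrow> nat \<Rightarrow> (real^4) set \<Rightarrow> (real^4) set set \<Rightarrow> bool" where
  "is_grid p q Q S \<longleftrightarrow> smooth_split_quadric Q \<and>
     (\<exists>\<R>\<in>rulings Q. \<exists>\<R>'\<in>rulings Q. \<R> \<noteq> \<R>' \<and>
       (\<exists>\<L>\<subseteq>\<R>. \<exists>\<M>\<subseteq>\<R>'. finite \<L> \<and> card \<L> = p \<and> finite \<M> \<and> card \<M> = q \<and>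
          S = {L \<inter> M | L M. L \<in> \<L> \<and> M \<in> \<M>} \<and> card S = p * q))"

definition quadric :: "real \<Rightarrow> (real^4) set" where
  "quadric c = {x. c\<^sup>2 * ((x$1)\<^sup>2 + (x$2)\<^sup>2) - ((x$3)\<^sup>2 + (x$4)\<^sup>2) = 0}"

definition dual_quadric :: "real \<Rightarrow> (real^4) set" where
  "dual_quadric c = {x. ((x$1)\<^sup>2 + (x$2)\<^sup>2) - c\<^sup>2 * ((x$3)\<^sup>2 + (x$4)\<^sup>2) = 0}"


section \<open>Parameters\<close>

text \<open>
  Residue classes are represented by integers throughout; everything below depends on \<open>a\<close>, \<open>b\<close>
  and on the indices only through their classes modulo \<open>p\<close>, \<open>q\<close>, respectively \<open>p * q\<close>.
\<close>

definition step_angle :: "nat \<Rightarrow> int \<Rightarrow> real" where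
  "step_angle m k = 2 * pi * of_int k / of_nat m"

definition c_squared :: "nat \<Rightarrow> nat \<Rightarrow> int \<Rightarrow> int \<Rightarrow> real" where
  "c_squared p q a b =
     - cos (step_angle p a - step_angle q b) / cos (step_angle p a + step_angle q b)"

text \<open>The condition on the denominator says that the quotient is finite.\<close>

definition admissible :: "nat \<Rightarrow> nat \<Rightarrow> int \<Rightarrow> int \<Rightarrow> bool" where
  "admissible p q a b \<longleftrightarrow> coprime a (int p) \<and> coprime b (int q) \<and>
     cos (step_angle p a + step_angle q b) \<noteq> 0 \<and> c_squared p q a b > 0 \<and> c_squared p q a b \<noteq> 1"

definition c_param :: "nat \<Rightarrow> nat \<Rightarrow> int \<Rightarrow> int \<Rightarrow> real" where
  "c_param p q a b = sqrt (c_squared p q a b)"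

definition index_grid :: "nat \<Rightarrow> nat \<Rightarrow> (int \<times> int) set" where
  "index_grid p q = {0..<int p} \<times> {0..<int q}"


section \<open>The dual-grid configuration\<close>

definition circ :: "real \<Rightarrow> real^2" where
  "circ \<theta> = vector [cos \<theta>, sin \<theta>]"

definition direct_sum :: "real^2 \<Rightarrow> real^2 \<Rightarrow> real^4" where
  "direct_sum u v = vector [u$1, u$2, v$1, v$2]"

definition A_ray :: "nat \<Rightarrow> nat \<Rightarrow> int \<Rightarrow> int \<Rightarrow> int \<Rightarrow> int \<Rightarrow> (real^4) set" where
  "A_ray p q a b i j =
     (let \<alpha> = step_angle p a; \<beta> = step_angle q b; c = c_param p q a b in
      ray (direct_sum (circ (of_int i * \<alpha> - of_int j * \<beta>))
                      (- c *\<^sub>R circ (of_int i * \<alpha> + of_int j * \<beta>))))"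

definition B_ray :: "nat \<Rightarrow> nat \<Rightarrow> int \<Rightarrow> int \<Rightarrow> int \<Rightarrow> int \<Rightarrow> (real^4) set" where
  "B_ray p q a b i j =
     (let \<alpha> = step_angle p a; \<beta> = step_angle q b; c = c_param p q a b in
      ray (direct_sum (c *\<^sub>R circ (of_int i * \<alpha> - of_int j * \<beta>))
                      (circ (of_int i * \<alpha> + of_int j * \<beta>))))"

definition A_set :: "nat \<Rightarrow> nat \<Rightarrow> int \<Rightarrow> int \<Rightarrow> (real^4) set set" where
  "A_set p q a b = (\<lambda>(i, j). A_ray p q a b i j) ` index_grid p q"

definition B_set :: "nat \<Rightarrow> nat \<Rightarrow> int \<Rightarrow> int \<Rightarrow> (real^4) set set" where
  "B_set p q a b = (\<lambda>(i, j). B_ray p q a b i j) ` index_grid p q"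

definition dual_grid :: "nat \<Rightarrow> nat \<Rightarrow> int \<Rightarrow> int \<Rightarrow> (real^4) set set" where
  "dual_grid p q a b = A_set p q a b \<union> B_set p q a b"

definition context_C :: "nat \<Rightarrow> nat \<Rightarrow> int \<Rightarrow> int \<Rightarrow> int \<Rightarrow> int \<Rightarrow> (real^4) set set" where
  "context_C p q a b i j =
     {A_ray p q a b i j, A_ray p q a b (i - 1) (j - 1),
      B_ray p q a b i (j - 1), B_ray p q a b (i - 1) j}"


section \<open>The Elford--Lisonek configuration\<close>

definition rot :: "real \<Rightarrow> real^2^2" where
  "rot \<theta> = vector [vector [cos \<theta>, - sin \<theta>], vector [sin \<theta>, cos \<theta>]]"

text \<open>
  The coordinates 1, 2, 3, 4 of \<open>real^4\<close> stand for the index pairs (1,1), (1,2), (2,1), (2,2).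
\<close>

definition kron_fst :: "4 \<Rightarrow> 2" where
  "kron_fst k = (if k = 1 \<or> k = 2 then 1 else 2)"

definition kron_snd :: "4 \<Rightarrow> 2" where
  "kron_snd k = (if k = 1 \<or> k = 3 then 1 else 2)"

definition kronecker :: "real^2^2 \<Rightarrow> real^2^2 \<Rightarrow> real^4^4" where
  "kronecker X Y = (\<chi> k l. X $ kron_fst k $ kron_fst l * Y $ kron_snd k $ kron_snd l)"

definition EL_matrix :: "nat \<Rightarrow> nat \<Rightarrow> int \<Rightarrow> int \<Rightarrow> real^4^4" where
  "EL_matrix p q a b = kronecker (rot (step_angle p a)) (rot (step_angle q b))"

definition EL_a :: "nat \<Rightarrow> nat \<Rightarrow> int \<Rightarrow> int \<Rightarrow> real^4" where
  "EL_a p q a b =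
     (let \<beta> = step_angle q b; c = c_param p q a b in
      vector [(1 - c) * cos \<beta>, (1 - c) * sin \<beta>, - (1 + c) * sin \<beta>, (1 + c) * cos \<beta>])"

definition EL_b :: "nat \<Rightarrow> nat \<Rightarrow> int \<Rightarrow> int \<Rightarrow> real^4" where
  "EL_b p q a b = (let c = c_param p q a b in vector [c + 1, 0, 0, c - 1])"

text \<open>
  \<open>EL_pow p q a b t v\<close> is \<open>M\<close> to the power \<open>t\<close> applied to \<open>v\<close>, for the class of \<open>t\<close> modulo
  \<open>d = p * q\<close>. Powers are iterated application, because \<open>*\<close> and \<open>^\<close> on matrices are componentwise.
\<close>

definition EL_pow :: "nat \<Rightarrow> nat \<Rightarrow> int \<Rightarrow> int \<Rightarrow> int \<Rightarrow> real^4 \<Rightarrow> real^4" where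
  "EL_pow p q a b t v = ((\<lambda>x. EL_matrix p q a b *v x) ^^ nat (t mod int (p * q))) v"

definition EL_a_ray :: "nat \<Rightarrow> nat \<Rightarrow> int \<Rightarrow> int \<Rightarrow> int \<Rightarrow> (real^4) set" where
  "EL_a_ray p q a b t = ray (EL_pow p q a b t (EL_a p q a b))"

definition EL_b_ray :: "nat \<Rightarrow> nat \<Rightarrow> int \<Rightarrow> int \<Rightarrow> int \<Rightarrow> (real^4) set" where
  "EL_b_ray p q a b t = ray (EL_pow p q a b t (EL_b p q a b))"

definition EL_a_orbit :: "nat \<Rightarrow> nat \<Rightarrow> int \<Rightarrow> int \<Rightarrow> (real^4) set set" where
  "EL_a_orbit p q a b = EL_a_ray p q a b ` {0..<int (p * q)}"

definition EL_b_orbit :: "nat \<Rightarrow> nat \<Rightarrow> int \<Rightarrow> int \<Rightarrow> (real^4) set set" where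
  "EL_b_orbit p q a b = EL_b_ray p q a b ` {0..<int (p * q)}"

definition EL_configuration :: "nat \<Rightarrow> nat \<Rightarrow> int \<Rightarrow> int \<Rightarrow> (real^4) set set" where
  "EL_configuration p q a b = EL_a_orbit p q a b \<union> EL_b_orbit p q a b"

definition EL_basis :: "nat \<Rightarrow> nat \<Rightarrow> int \<Rightarrow> int \<Rightarrow> int \<Rightarrow> int \<Rightarrow> (real^4) set set" where
  "EL_basis p q a b r t =
     {EL_a_ray p q a b t, EL_a_ray p q a b (t - 1),
      EL_b_ray p q a b t, EL_b_ray p q a b (t - r)}"

end

theory Submission imports Defs begin

text \<open>
  Identifying \<open>real^4\<close> with 2-by-2 matrices, \<open>M\<close> acts by \<open>X \<mapsto> R\<^sub>\<alpha> X R\<^sub>-\<^sub>\<beta>\<close>. Splitting \<open>X\<close> into its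
  conformal and anticonformal part is an orthogonal map that turns this action into the pair of plane
  rotations by \<open>\<alpha> - \<beta>\<close> and \<open>\<alpha> + \<beta>\<close>; it sends the ray of \<open>M\<^sup>t a\<close> to \<open>A\<close> at \<open>(t, t + 1)\<close>, the ray of \<open>M\<^sup>t b\<close>
  to \<open>B\<close> at \<open>(t, t)\<close>, and \<open>E\<^sub>t\<close> to the context at \<open>(t, t + 1)\<close>. By the Chinese remainder theorem these
  diagonal indices exhaust the grid.
\<close>

section \<open>Vectors on the two quadrics\<close>

text \<open>The signed radii cover both families at once: (1, -c) for the points A, (c, 1) for the
  points B. One argument then serves both grids.\<close>

definition torus_vec :: "real \<Rightarrow> real \<Rightarrow> real \<Rightarrow> real \<Rightarrow> real^4" where
  "torus_vec s s' \<phi> \<psi> = direct_sum (s *\<^sub>R circ \<phi>) (s' *\<^sub>R circ \<psi>)"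

lemma vector_4 [simp]:
  "(vector [x, y, z, w] :: 'a::zero^4) $ 1 = x"
  "(vector [x, y, z, w] :: 'a^4) $ 2 = y"
  "(vector [x, y, z, w] :: 'a^4) $ 3 = z"
  "(vector [x, y, z, w] :: 'a^4) $ 4 = w"
  unfolding vector_def by auto

lemma torus_vec_nth [simp]:
  "torus_vec s s' \<phi> \<psi> $ 1 = s * cos \<phi>" "torus_vec s s' \<phi> \<psi> $ 2 = s * sin \<phi>"
  "torus_vec s s' \<phi> \<psi> $ 3 = s' * cos \<psi>" "torus_vec s s' \<phi> \<psi> $ 4 = s' * sin \<psi>"
  by (simp_all add: torus_vec_def direct_sum_def circ_def)

lemma inner_torus_vec:
  "torus_vec s s' \<phi> \<psi> \<bullet> torus_vec r r' \<phi>' \<psi>' = s * r * cos (\<phi> - \<phi>') + s' * r' * cos (\<psi> - \<psi>')"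
  by (simp add: inner_vec_def sum_4 cos_diff algebra_simps)

lemma torus_vec_nonzero: "s \<noteq> 0 \<Longrightarrow> torus_vec s s' \<phi> \<psi> \<noteq> 0"
  by (metis cos_zero no_zero_divisors torus_vec_nth(1,2) zero_index sin_zero_abs_cos_one abs_zero zero_neq_one)

lemma torus_vec_periodic:
  "torus_vec s s' (\<phi> + 2 * pi * of_int m) (\<psi> + 2 * pi * of_int n) = torus_vec s s' \<phi> \<psi>"
  using sin_cos_eq_iff[of "\<phi> + 2 * pi * of_int m" \<phi>] sin_cos_eq_iff[of "\<psi> + 2 * pi * of_int n" \<psi>]
  unfolding vec_eq_iff forall_4 torus_vec_nth by metis

section \<open>Rays and orthogonal bases of rays\<close>

lemma is_ray_ray: "v \<noteq> 0 \<Longrightarrow> is_ray (ray v)"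
  by (simp add: is_ray_def ray_def)

lemma ray_eq: "ray v = range (\<lambda>k. k *\<^sub>R v)"
  by (simp add: ray_def span_singleton)

lemma ray_scaleR: "k \<noteq> 0 \<Longrightarrow> ray (k *\<^sub>R v) = ray v"
  unfolding ray_eq
  by (auto simp: image_iff) (metis nonzero_eq_divide_eq)

lemma image_ray: "(\<lambda>x. P *v x) ` ray v = ray (P *v v)"
  unfolding ray_eq image_image by (simp add: matrix_vector_mult_scaleR)

text \<open>A nonzero vector is not orthogonal to itself, so orthogonal spanning vectors give
  different rays; hence the cardinality 4.\<close>

lemma orthogonal_ray_basisI:
  assumes "v1 \<noteq> 0" "v2 \<noteq> 0" "v3 \<noteq> 0" "v4 \<noteq> 0"
    and "v1 \<bullet> v2 = 0" "v1 \<bullet> v3 = 0" "v1 \<bullet> v4 = 0" "v2 \<bullet> v3 = 0" "v2 \<bullet> v4 = 0" "v3 \<bullet> v4 = 0"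
  shows "orthogonal_ray_basis {ray v1, ray v2, ray v3, ray v4}"
proof -
  have neq: "ray v \<noteq> ray w" if "v \<bullet> w = 0" "v \<noteq> 0" for v w
  proof
    assume "ray v = ray w"
    then have "v \<in> ray w"
      by (metis ray_def span_base singletonI)
    with that show False
      by (auto simp: ray_eq)
  qed
  have "card {ray v1, ray v2, ray v3, ray v4} = 4"
    using assms by (simp add: neq)
  then show ?thesis
    unfolding orthogonal_ray_basis_def
    by (simp add: is_ray_ray[unfolded ray_eq] ray_eq orthogonal_def assms assms(5-)[THEN trans[OF inner_commute]])
qed

section \<open>Orthogonal matrices acting on rays\<close>

lemma inj_orthogonal_matrix:
  fixes P :: "real^'n^'n"
  shows "orthogonal_matrix P \<Longrightarrow> inj (\<lambda>x. P *v x)"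
  by (metis orthogonal_matrix_def inj_on_inverseI matrix_vector_mul_assoc matrix_vector_mul_lid)

lemma dim_orthogonal_image:
  fixes P :: "real^'n^'n"
  assumes "orthogonal_matrix P"
  shows "dim ((\<lambda>x. P *v x) ` L) = dim L"
  using inj_on_subset[OF inj_orthogonal_matrix[OF assms]]
  by (intro dim_image_eq) (auto simp: matrix_vector_mul_linear)

lemma inner_orthogonal_matrix:
  fixes P :: "real^'n^'n"
  shows "orthogonal_matrix P \<Longrightarrow> (P *v x) \<bullet> (P *v y) = x \<bullet> y"
  using orthogonal_transformation_matrix[of "\<lambda>x. P *v x"]
  by (simp add: orthogonal_transformation_def matrix_of_matrix_vector_mul matrix_vector_mul_linear)

lemma orthogonal_ray_basis_image:
  assumes P: "orthogonal_matrix P" and S: "orthogonal_ray_basis S"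
  shows "orthogonal_ray_basis (ray_image P S)"
proof -
  have "card (ray_image P S) = card S"
    unfolding ray_image_def
    by (intro card_image inj_onI) (simp add: inj_image_eq_iff[OF inj_orthogonal_matrix[OF P]])
  moreover have "is_ray ((\<lambda>x. P *v x) ` L)" if "L \<in> S" for L
    using that S P
    by (auto simp: orthogonal_ray_basis_def is_ray_def dim_orthogonal_image linear_subspace_image
        matrix_vector_mul_linear)
  moreover have "\<forall>x\<in>(\<lambda>x. P *v x) ` L. \<forall>y\<in>(\<lambda>x. P *v x) ` L'. orthogonal x y"
    if "L \<in> S" "L' \<in> S" "(\<lambda>x. P *v x) ` L \<noteq> (\<lambda>x. P *v x) ` L'" for L L'
  proof -
    have "L \<noteq> L'"
      using that(3) by blast
    then show ?thesis
      using S that(1,2) by (simp add: orthogonal_ray_basis_def orthogonal_def inner_orthogonal_matrix[OF P])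
  qed
  ultimately show ?thesis
    using S unfolding orthogonal_ray_basis_def ray_image_def by (simp add: ball_simps)
qed


section \<open>Grids cut out by two rulings\<close>

text \<open>The locus |u| : |v| = |s| : |s'|, which contains every
  \<open>torus_vec s s' \<phi> \<psi>\<close>. Only squares of the radii enter, so (1, -c) yields
  Q_c and (c, 1) its dual.\<close>

definition scaled_quadric :: "real \<Rightarrow> real \<Rightarrow> (real^4) set" where
  "scaled_quadric s s' = {x. s'\<^sup>2 * ((x$1)\<^sup>2 + (x$2)\<^sup>2) = s\<^sup>2 * ((x$3)\<^sup>2 + (x$4)\<^sup>2)}"

text \<open>
  The graph of \<open>s' / s\<close> times the rotation (for \<open>e = 1\<close>) or the reflection (for \<open>e = - 1\<close>) with
  angle \<open>\<theta>\<close>; these graphs form the two rulings of \<open>scaled_quadric s s'\<close>.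
\<close>

definition ruling_line :: "real \<Rightarrow> real \<Rightarrow> real \<Rightarrow> real \<Rightarrow> (real^4) set" where
  "ruling_line s s' e \<theta> =
     {x. s * x$3 = s' * (cos \<theta> * x$1 - e * sin \<theta> * x$2) \<and>
         s * x$4 = s' * (sin \<theta> * x$1 + e * cos \<theta> * x$2)}"

lemma ruling_line_in_lines_on:
  assumes s: "s \<noteq> 0" and e: "e * e = 1"
  shows "ruling_line s s' e \<theta> \<in> lines_on (scaled_quadric s s')"
proof -
  \<comment> \<open>The points of the graph above (s, 0) and (0, s); they will span the
    line.\<close>
  define v1 v2 :: "real^4" where "v1 = vector [s, 0, s' * cos \<theta>, s' * sin \<theta>]"
    and "v2 = vector [0, s, - s' * e * sin \<theta>, s' * e * cos \<theta>]"
  have "v2 \<notin> span {v1}"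
  proof
    assume "v2 \<in> span {v1}"
    then obtain k where "v2 = k *\<^sub>R v1"
      by (auto simp: span_singleton)
    then have "v2 $ 1 = k * v1 $ 1" "v2 $ 2 = k * v1 $ 2"
      by simp_all
    with s show False
      by (simp add: v1_def v2_def)
  qed
  moreover have "v1 \<noteq> 0" "v1 \<noteq> v2"
    using s by (auto simp: v1_def v2_def vec_eq_iff forall_4)
  ultimately have "independent {v2, v1}" "card {v2, v1} = 2"
    by (simp_all add: independent_insert)
  then have "dim {v1, v2} = 2"
    by (metis dim_eq_card_independent insert_commute)
  moreover have "ruling_line s s' e \<theta> = span {v1, v2}"
  proof (intro equalityI subsetI)
    fix x assume x: "x \<in> ruling_line s s' e \<theta>"
    have "x = (x$1 / s) *\<^sub>R v1 + (x$2 / s) *\<^sub>R v2"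
      using x s by (auto simp: vec_eq_iff forall_4 ruling_line_def v1_def v2_def field_simps)
    then show "x \<in> span {v1, v2}"
      by (metis span_add span_base span_scale insertCI)
  next
    fix x assume "x \<in> span {v1, v2}"
    then obtain k l where "x = k *\<^sub>R v1 + l *\<^sub>R v2"
      by (auto simp: span_insert span_singleton) (metis add.commute diff_eq_eq)
    then show "x \<in> ruling_line s s' e \<theta>"
      by (simp add: ruling_line_def v1_def v2_def algebra_simps)
  qed
  moreover have "ruling_line s s' e \<theta> \<subseteq> scaled_quadric s s'"
  proof
    fix x assume x: "x \<in> ruling_line s s' e \<theta>"
    \<comment> \<open>The graph is that of s'/s times an isometry. The factor \<open>e * e\<close>
      stays symbolic until the last step, so that the identity is polynomial.\<close>
    have "s\<^sup>2 * ((x$3)\<^sup>2 + (x$4)\<^sup>2) = (s * x$3)\<^sup>2 + (s * x$4)\<^sup>2"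
      by algebra
    also have "\<dots> = s'\<^sup>2 * (((x$1)\<^sup>2 + e * e * (x$2)\<^sup>2) * ((cos \<theta>)\<^sup>2 + (sin \<theta>)\<^sup>2))"
      using x unfolding ruling_line_def mem_Collect_eq by algebra
    finally show "x \<in> scaled_quadric s s'"
      using e by (simp add: scaled_quadric_def)
  qed
  ultimately show ?thesis
    by (simp add: lines_on_def)
qed

lemma zero_in_ruling_line: "0 \<in> ruling_line s s' e \<theta>"
  by (simp add: ruling_line_def)

text \<open>The difference of two rotations, or of two reflections, with distinct angles is a
  similarity with nonzero factor. A common point therefore has u = 0, and then v = 0.\<close>

lemma ruling_line_disjoint:
  assumes "s \<noteq> 0" "s' \<noteq> 0" "e * e = 1" "circ \<theta> \<noteq> circ \<theta>'"
  shows "ruling_line s s' e \<theta> \<inter> ruling_line s s' e \<theta>' = {0}"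
proof (intro equalityI subsetI)
  fix x assume x: "x \<in> ruling_line s s' e \<theta> \<inter> ruling_line s s' e \<theta>'"
  let ?C = "cos \<theta> - cos \<theta>'" and ?S = "sin \<theta> - sin \<theta>'"
  have "?C \<noteq> 0 \<or> ?S \<noteq> 0"
    using assms(4) by (auto simp: circ_def vec_eq_iff forall_2)
  then have pos: "?C\<^sup>2 + ?S\<^sup>2 \<noteq> 0"
    by (simp add: sum_power2_eq_zero_iff)
  have 1: "?C * x$1 = e * ?S * x$2" and 2: "?S * x$1 = - e * ?C * x$2"
  proof -
    have "s' * (?C * x$1) = s' * (e * ?S * x$2)" "s' * (?S * x$1) = s' * (- e * ?C * x$2)"
      using x unfolding ruling_line_def Int_iff mem_Collect_eq by algebra+
    with assms(2) show "?C * x$1 = e * ?S * x$2" "?S * x$1 = - e * ?C * x$2"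
      by (metis mult_left_cancel)+
  qed
  \<comment> \<open>Up to sign, \<open>?C\<^sup>2 + ?S\<^sup>2\<close> is the determinant of the
    linear system given by 1 and 2.\<close>
  have "(?C\<^sup>2 + ?S\<^sup>2) * x$1 = 0"
    using 1 2 by algebra
  moreover have "(?C\<^sup>2 + ?S\<^sup>2) * x$2 = 0"
    using 1 2 assms(3) by algebra
  ultimately have "x$1 = 0" "x$2 = 0"
    using pos by auto
  with x assms(1) have "x$3 = 0" "x$4 = 0"
    by (auto simp: ruling_line_def)
  with \<open>x$1 = 0\<close> \<open>x$2 = 0\<close> show "x \<in> {0}"
    by (simp add: vec_eq_iff forall_4)
qed (auto simp: zero_in_ruling_line)

text \<open>With u and v read as complex numbers, the lines are s v = s' exp(i(\<phi>+\<psi>))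
  conj(u) and s v = s' exp(i(\<psi>-\<phi>)) u. Equating them makes exp(-i\<phi>) u real, which
  leaves one real parameter.\<close>

lemma ruling_line_Int:
  assumes s: "s \<noteq> 0" "s' \<noteq> 0"
  shows "ruling_line s s' (- 1) (\<phi> + \<psi>) \<inter> ruling_line s s' 1 (\<psi> - \<phi>) = ray (torus_vec s s' \<phi> \<psi>)"
proof (intro equalityI subsetI)
  fix x assume x: "x \<in> ruling_line s s' (- 1) (\<phi> + \<psi>) \<inter> ruling_line s s' 1 (\<psi> - \<phi>)"
  \<comment> \<open>\<open>D\<close> is minus the imaginary part of exp(-i\<phi>) u, and
    \<open>k\<close> is its real part divided by \<open>s\<close>.\<close>
  define D where "D = sin \<phi> * x$1 - cos \<phi> * x$2"
  define k where "k = (cos \<phi> * x$1 + sin \<phi> * x$2) / s"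
  have "sin \<psi> * D = 0" "cos \<psi> * D = 0"
  proof -
    have "2 * s' * (sin \<psi> * D) = 0" "2 * s' * (cos \<psi> * D) = 0"
      using x unfolding D_def ruling_line_def Int_iff mem_Collect_eq cos_add cos_diff sin_add sin_diff
      by algebra+
    with s(2) show "sin \<psi> * D = 0" "cos \<psi> * D = 0"
      by auto
  qed
  then have "D = 0"
    by (metis mult_eq_0_iff cos_zero sin_zero_abs_cos_one abs_zero zero_neq_one)
  have ks: "k * s = cos \<phi> * x$1 + sin \<phi> * x$2"
    using s by (simp add: k_def)
  have 1: "x$1 = k * s * cos \<phi>" and 2: "x$2 = k * s * sin \<phi>"
    unfolding ks using \<open>D = 0\<close> sin_cos_squared_add[of \<phi>] unfolding D_def by algebra+
  have 3: "s * x$3 = s * (k * (s' * cos \<psi>))" and 4: "s * x$4 = s * (k * (s' * sin \<psi>))"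
  proof -
    have "s * x$3 = s' * (cos (\<psi> - \<phi>) * x$1 - sin (\<psi> - \<phi>) * x$2)"
      and "s * x$4 = s' * (sin (\<psi> - \<phi>) * x$1 + cos (\<psi> - \<phi>) * x$2)"
      using x by (auto simp: ruling_line_def)
    then show "s * x$3 = s * (k * (s' * cos \<psi>))" "s * x$4 = s * (k * (s' * sin \<psi>))"
      unfolding 1 2 cos_diff sin_diff using sin_cos_squared_add[of \<phi>] by algebra+
  qed
  have "x = k *\<^sub>R torus_vec s s' \<phi> \<psi>"
    using 1 2 3 4 s by (simp add: vec_eq_iff forall_4)
  then show "x \<in> ray (torus_vec s s' \<phi> \<psi>)"
    by (auto simp: ray_eq)
next
  fix x assume "x \<in> ray (torus_vec s s' \<phi> \<psi>)"
  then obtain k where x: "x = k *\<^sub>R torus_vec s s' \<phi> \<psi>"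
    by (auto simp: ray_eq)
  \<comment> \<open>Writing \<psi> in terms of each line's angle turns the membership equations into
    addition formulas.\<close>
  have "cos \<psi> = cos ((\<phi> + \<psi>) - \<phi>)" "sin \<psi> = sin ((\<phi> + \<psi>) - \<phi>)"
       "cos \<psi> = cos ((\<psi> - \<phi>) + \<phi>)" "sin \<psi> = sin ((\<psi> - \<phi>) + \<phi>)"
    by simp_all
  then have "cos \<psi> = cos (\<phi> + \<psi>) * cos \<phi> + sin (\<phi> + \<psi>) * sin \<phi>"
       "sin \<psi> = sin (\<phi> + \<psi>) * cos \<phi> - cos (\<phi> + \<psi>) * sin \<phi>"
       "cos \<psi> = cos (\<psi> - \<phi>) * cos \<phi> - sin (\<psi> - \<phi>) * sin \<phi>"
       "sin \<psi> = sin (\<psi> - \<phi>) * cos \<phi> + cos (\<psi> - \<phi>) * sin \<phi>"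
    unfolding cos_diff[of "\<phi> + \<psi>" \<phi>] sin_diff[of "\<phi> + \<psi>" \<phi>]
      cos_add[of "\<psi> - \<phi>" \<phi>] sin_add[of "\<psi> - \<phi>" \<phi>] by blast+
  then show "x \<in> ruling_line s s' (- 1) (\<phi> + \<psi>) \<inter> ruling_line s s' 1 (\<psi> - \<phi>)"
    unfolding ruling_line_def x Int_iff mem_Collect_eq vector_scaleR_component torus_vec_nth real_scaleR_def
    by algebra
qed

lemma smooth_split_scaled_quadric:
  assumes s: "s \<noteq> 0" "s' \<noteq> 0"
  shows "smooth_split_quadric (scaled_quadric s s')"
proof -
  \<comment> \<open>The diagonal of the Gram matrix of the quadratic form, and its entrywise
    inverse.\<close>
  define d d' :: "real^4" where "d = vector [s'\<^sup>2, s'\<^sup>2, - s\<^sup>2, - s\<^sup>2]"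
    and "d' = vector [1 / s'\<^sup>2, 1 / s'\<^sup>2, - 1 / s\<^sup>2, - 1 / s\<^sup>2]"
  define G G' :: "real^4^4" where "G = (\<chi> i j. if i = j then d $ i else 0)"
    and "G' = (\<chi> i j. if i = j then d' $ i else 0)"
  have "transpose G = G"
    by (auto simp: G_def transpose_def vec_eq_iff)
  moreover have "G ** G' = mat 1" "G' ** G = mat 1"
    using s by (simp_all add: G_def G'_def matrix_matrix_mult_def mat_def vec_eq_iff forall_4 sum_4 d_def d'_def)
  then have "invertible G"
    by (auto simp: invertible_def)
  moreover have "scaled_quadric s s' = {x. x \<bullet> (G *v x) = 0}"
  proof -
    have Gx: "(G *v x) $ i = d $ i * x $ i" for x i
      by (simp add: G_def matrix_vector_mult_def if_distrib if_distribR sum.delta cong: if_cong)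
    show ?thesis
      by (auto simp: scaled_quadric_def inner_vec_def sum_4 Gx d_def algebra_simps power2_eq_square)
  qed
  moreover have "lines_on (scaled_quadric s s') \<noteq> {}"
    using ruling_line_in_lines_on[of s 1] s by auto
  ultimately show ?thesis
    unfolding smooth_split_quadric_def by blast
qed

lemma torus_rays_on_quadric:
  assumes "s \<noteq> 0"
  shows "ray (torus_vec s s' \<phi> \<psi>) \<in> rays_on (scaled_quadric s s')"
proof -
  have "k *\<^sub>R torus_vec s s' \<phi> \<psi> \<in> scaled_quadric s s'" for k
  proof -
    have "s'\<^sup>2 * ((k * (s * cos \<phi>))\<^sup>2 + (k * (s * sin \<phi>))\<^sup>2)
        = s\<^sup>2 * ((k * (s' * cos \<psi>))\<^sup>2 + (k * (s' * sin \<psi>))\<^sup>2)"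
      using sin_cos_squared_add[of \<phi>] sin_cos_squared_add[of \<psi>] by algebra
    then show ?thesis
      by (simp add: scaled_quadric_def)
  qed
  then show ?thesis
    using assms is_ray_ray[OF torus_vec_nonzero, of s s' \<phi> \<psi>]
    by (auto simp: rays_on_def ray_eq)
qed

text \<open>
  The line of a point with angles \<open>(x i - y j, x i + y j)\<close> in one ruling depends only on the sum
  \<open>2 * x i\<close> of the angles, its line in the other ruling only on their difference \<open>2 * y j\<close>.
\<close>

lemma is_grid_torus:
  fixes x y :: "int \<Rightarrow> real"
  assumes s: "s \<noteq> 0" "s' \<noteq> 0" and "p > 0" "q > 0"
    and x: "inj_on (\<lambda>i. circ (2 * x i)) {0..<int p}" and y: "inj_on (\<lambda>j. circ (2 * y j)) {0..<int q}"
  shows "is_grid p q (scaled_quadric s s')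
           ((\<lambda>(i, j). ray (torus_vec s s' (x i - y j) (x i + y j))) ` index_grid p q)"
proof -
  let ?Q = "scaled_quadric s s'" and ?I = "{0..<int p}" and ?J = "{0..<int q}"
  define L where "L i = ruling_line s s' (- 1) (2 * x i)" for i
  define M where "M j = ruling_line s s' 1 (2 * y j)" for j
  define K where "K i j = ray (torus_vec s s' (x i - y j) (x i + y j))" for i j
  have LM: "L i \<inter> M j = K i j" for i j
    using ruling_line_Int[OF s, of "x i - y j" "x i + y j"] by (simp add: L_def M_def K_def)
  have dimK: "dim (K i j) = 1" for i j
    using is_ray_ray[OF torus_vec_nonzero[OF s(1)]] by (simp add: K_def is_ray_def)
  then have K: "K i j \<noteq> {0}" for i j
    by (metis dim_singleton zero_neq_one)
  have zero: "0 \<in> K i j" for i j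
    unfolding LM[symmetric] by (simp add: L_def M_def zero_in_ruling_line)
  have L: "L i \<in> lines_on ?Q" and M: "M j \<in> lines_on ?Q" for i j
    using s by (auto simp: L_def M_def intro: ruling_line_in_lines_on)
  have LL: "L i \<inter> L i' = {0}" if "i \<in> ?I" "i' \<in> ?I" "i \<noteq> i'" for i i'
    unfolding L_def using that inj_onD[OF x] s by (intro ruling_line_disjoint) auto
  have MM: "M j \<inter> M j' = {0}" if "j \<in> ?J" "j' \<in> ?J" "j \<noteq> j'" for j j'
    unfolding M_def using that inj_onD[OF y] s by (intro ruling_line_disjoint) auto
  have injL: "inj_on L ?I"
  proof (rule inj_onI, rule ccontr)
    fix i i' assume "i \<in> ?I" "i' \<in> ?I" "L i = L i'" "i \<noteq> i'"
    with LL[of i i'] LM[of i 0] K[of i 0] zero[of i 0] show False by auto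
  qed
  have injM: "inj_on M ?J"
  proof (rule inj_onI, rule ccontr)
    fix j j' assume "j \<in> ?J" "j' \<in> ?J" "M j = M j'" "j \<noteq> j'"
    with MM[of j j'] LM[of 0 j] K[of 0 j] zero[of 0 j] show False by auto
  qed
  have "inj_on (\<lambda>(i, j). K i j) (index_grid p q)"
  proof (rule inj_onI, clarify, rule conjI; rule ccontr)
    fix i j i' j'
    assume *: "(i, j) \<in> index_grid p q" "(i', j') \<in> index_grid p q" "K i j = K i' j'"
    \<comment> \<open>If two grid points with different indices coincided, their ray would lie on
      two disjoint lines of one family.\<close>
    have sub: "K i j \<subseteq> L i \<inter> L i'" "K i j \<subseteq> M j \<inter> M j'"
      using *(3) LM[of i j] LM[of i' j'] by auto
    have not_zero: "\<not> K i j \<subseteq> {0}"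
      using K[of i j] zero[of i j] by auto
    show False if "i \<noteq> i'"
      using * that LL[of i i'] sub(1) not_zero by (auto simp: index_grid_def)
    show False if "j \<noteq> j'"
      using * that MM[of j j'] sub(2) not_zero by (auto simp: index_grid_def)
  qed
  then have card: "card ((\<lambda>(i, j). K i j) ` index_grid p q) = p * q"
    by (simp add: card_image index_grid_def card_cartesian_product)
  have image: "(\<lambda>(i, j). K i j) ` index_grid p q = {L' \<inter> M' | L' M'. L' \<in> L ` ?I \<and> M' \<in> M ` ?J}"
    by (auto simp: index_grid_def LM[symmetric])
  \<comment> \<open>Each ruling is taken as the class of the line with index 0. The other lines of
    the family belong to it because they are disjoint from that line.\<close>
  define R where "R = same_ruling ?Q `` {L 0}"
  define R' where "R' = same_ruling ?Q `` {M 0}"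
  have "R \<in> rulings ?Q" "R' \<in> rulings ?Q"
    using L M by (auto simp: R_def R'_def rulings_def intro: quotientI)
  moreover have "L ` ?I \<subseteq> R"
  proof (rule image_subsetI)
    fix i assume "i \<in> ?I"
    with LL[of 0 i] have "L 0 = L i \<or> L 0 \<inter> L i = {0}"
      using \<open>p > 0\<close> by (cases "i = 0") simp_all
    with L[of 0] L[of i] show "L i \<in> R"
      by (simp add: R_def same_ruling_def)
  qed
  moreover have "M ` ?J \<subseteq> R'"
  proof (rule image_subsetI)
    fix j assume "j \<in> ?J"
    with MM[of 0 j] have "M 0 = M j \<or> M 0 \<inter> M j = {0}"
      using \<open>q > 0\<close> by (cases "j = 0") simp_all
    with M[of 0] M[of j] show "M j \<in> R'"
      by (simp add: R'_def same_ruling_def)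
  qed
  moreover have "R \<noteq> R'"
  proof -
    \<comment> \<open>\<open>L 0\<close> and \<open>M 0\<close> meet in a ray, so they are neither
      equal nor disjoint; thus \<open>L 0\<close> separates the two classes.\<close>
    have "dim (L 0) = 2"
      using L by (simp add: lines_on_def)
    then have "L 0 \<noteq> M 0"
      using LM[of 0 0] dimK[of 0 0] by auto
    then have "L 0 \<notin> R'"
      using LM[of 0 0] K[of 0 0] by (auto simp: R'_def same_ruling_def)
    moreover have "L 0 \<in> R"
      using L by (simp add: R_def same_ruling_def)
    ultimately show ?thesis by blast
  qed
  ultimately show ?thesis
    unfolding is_grid_def K_def[symmetric]
    using smooth_split_scaled_quadric[OF s] card image card_image[OF injL] card_image[OF injM]
    by (intro conjI bexI[of _ R] bexI[of _ R'] exI[of _ "L ` ?I"] exI[of _ "M ` ?J"]) (assumption | simp)+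
qed


section \<open>The dual-grid configuration\<close>

lemma A_ray_eq:
  "A_ray p q a b i j = ray (torus_vec 1 (- c_param p q a b)
     (of_int i * step_angle p a - of_int j * step_angle q b)
     (of_int i * step_angle p a + of_int j * step_angle q b))"
  by (simp add: A_ray_def torus_vec_def Let_def)

lemma B_ray_eq:
  "B_ray p q a b i j = ray (torus_vec (c_param p q a b) 1
     (of_int i * step_angle p a - of_int j * step_angle q b)
     (of_int i * step_angle p a + of_int j * step_angle q b))"
  by (simp add: B_ray_def torus_vec_def Let_def)

lemma step_angle_cong:
  assumes "m > 0" "[i = i'] (mod int m)"
  shows "\<exists>n::int. of_int i * step_angle m k = of_int i' * step_angle m k + 2 * pi * of_int n"
proof -
  obtain l where "i = i' + int m * l"
    using assms(2) by (metis cong_iff_lin cong_sym)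
  then have "of_int i * step_angle m k = of_int i' * step_angle m k + 2 * pi * of_int (l * k)"
    using assms(1) by (simp add: step_angle_def field_simps)
  then show ?thesis ..
qed

text \<open>The shifts of the indices add 2 pi (m - n) and 2 pi (m + n) to the two angles. This
  makes the points A and B well defined on Z_p x Z_q.\<close>

lemma torus_vec_cong:
  assumes "p > 0" "q > 0" "[i = i'] (mod int p)" "[j = j'] (mod int q)"
  shows "torus_vec s s' (of_int i * step_angle p a - of_int j * step_angle q b)
           (of_int i * step_angle p a + of_int j * step_angle q b) =
         torus_vec s s' (of_int i' * step_angle p a - of_int j' * step_angle q b)
           (of_int i' * step_angle p a + of_int j' * step_angle q b)"
proof -
  let ?x = "of_int i' * step_angle p a" and ?y = "of_int j' * step_angle q b"
  obtain m n where mn: "of_int i * step_angle p a = ?x + 2 * pi * of_int m"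
    "of_int j * step_angle q b = ?y + 2 * pi * of_int n"
    using step_angle_cong assms by metis
  have "?x + 2 * pi * of_int m - (?y + 2 * pi * of_int n) = ?x - ?y + 2 * pi * of_int (m - n)"
    "?x + 2 * pi * of_int m + (?y + 2 * pi * of_int n) = ?x + ?y + 2 * pi * of_int (m + n)"
    by (simp_all add: algebra_simps)
  then show ?thesis
    unfolding mn by (simp only: torus_vec_periodic)
qed

lemma
  assumes "p > 0" "q > 0" "[i = i'] (mod int p)" "[j = j'] (mod int q)"
  shows A_ray_cong: "A_ray p q a b i j = A_ray p q a b i' j'"
    and B_ray_cong: "B_ray p q a b i j = B_ray p q a b i' j'"
  unfolding A_ray_eq B_ray_eq using torus_vec_cong[OF assms] by simp_all

lemma context_C_cong:
  assumes "p > 0" "q > 0" "[i = i'] (mod int p)" "[j = j'] (mod int q)"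
  shows "context_C p q a b i j = context_C p q a b i' j'"
  unfolding context_C_def
  using assms by (simp add: cong_diff A_ray_cong[of p q i i' j j'] B_ray_cong[of p q i i' "j - 1" "j' - 1"]
      A_ray_cong[of p q "i - 1" "i' - 1" "j - 1" "j' - 1"] B_ray_cong[of p q "i - 1" "i' - 1" j j'])

section \<open>Orthogonality of the contexts\<close>

lemma c_param_admissible:
  assumes "admissible p q a b"
  shows "c_param p q a b > 0" "c_param p q a b \<noteq> 1"
    and "(c_param p q a b)\<^sup>2 * cos (step_angle p a + step_angle q b) = - cos (step_angle p a - step_angle q b)"
  using assms by (auto simp: admissible_def c_param_def) (auto simp: c_squared_def)

text \<open>For the pair of A rays and for the pair of B rays, the inner product is
  cos(\<alpha>-\<beta>) + c^2 cos(\<alpha>+\<beta>), which vanishes by the choice of c. For an A ray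
  and a B ray, the two angle differences agree up to sign, and the terms with coefficients c and -c
  cancel.\<close>

lemma orthogonal_context_C:
  assumes "admissible p q a b"
  shows "orthogonal_ray_basis (context_C p q a b i j)"
proof -
  define \<alpha> \<beta> c where "\<alpha> = step_angle p a" "\<beta> = step_angle q b" "c = c_param p q a b"
  note defs = this[symmetric]
  have c: "c > 0" "c\<^sup>2 * cos (\<alpha> + \<beta>) = - cos (\<alpha> - \<beta>)"
    using c_param_admissible[OF assms] by (auto simp: defs)
  have c2: "c * c * cos (\<alpha> + \<beta>) = - cos (\<alpha> - \<beta>)" "c * c * cos (\<beta> + \<alpha>) = - cos (\<alpha> - \<beta>)"
    "cos (\<beta> - \<alpha>) = cos (\<alpha> - \<beta>)"
    using c(2) cos_minus[of "\<alpha> - \<beta>"] by (simp_all add: power2_eq_square add.commute)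
  show ?thesis
    unfolding context_C_def A_ray_eq B_ray_eq defs
    using c(1) c2
    by (intro orthogonal_ray_basisI)
      (simp_all add: torus_vec_nonzero inner_torus_vec algebra_simps)
qed

text \<open>The doubled angle amounts to multiplying the index by 2k, which is invertible modulo m
  because m is odd.\<close>

lemma inj_on_circ_step:
  assumes "odd m" "coprime k (int m)"
  shows "inj_on (\<lambda>i. circ (2 * (of_int i * step_angle m k))) {0..<int m}"
proof (rule inj_onI)
  fix i j assume ij: "i \<in> {0..<int m}" "j \<in> {0..<int m}"
    and "circ (2 * (of_int i * step_angle m k)) = circ (2 * (of_int j * step_angle m k))"
  then have "cos (2 * (of_int i * step_angle m k)) = cos (2 * (of_int j * step_angle m k))"
    "sin (2 * (of_int i * step_angle m k)) = sin (2 * (of_int j * step_angle m k))"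
    by (auto simp: circ_def vec_eq_iff forall_2)
  then obtain n :: int where
    "2 * (of_int i * step_angle m k) = 2 * (of_int j * step_angle m k) + 2 * pi * of_int n"
    using sin_cos_eq_iff by blast
  moreover have "m > 0"
    using assms(1) by (cases m) auto
  ultimately have "pi * of_int (i * (2 * k)) = pi * of_int (j * (2 * k) + int m * n)"
    by (simp add: step_angle_def field_simps)
  then have "i * (2 * k) = j * (2 * k) + int m * n"
    by (metis mult_left_cancel pi_neq_zero of_int_eq_iff)
  then have "[i * (2 * k) = j * (2 * k)] (mod int m)"
    by (simp add: cong_def)
  moreover have "coprime (2 * k) (int m)"
    using assms by simp
  ultimately show "i = j"
    using ij cong_less_imp_eq_int[of i "int m" j] by (simp add: cong_mult_rcancel)
qed

section \<open>The two quadrics and the disjointness of the grids\<close>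

lemma
  shows quadric_eq: "quadric c = scaled_quadric 1 (- c)"
    and dual_quadric_eq: "dual_quadric c = scaled_quadric c 1"
  by (auto simp: quadric_def dual_quadric_def scaled_quadric_def)

text \<open>Substituting one equation into the other gives (1 - c^4) |u|^2 = 0.\<close>

lemma quadric_Int_dual_quadric:
  assumes "c > 0" "c \<noteq> 1" "x \<in> quadric c" "x \<in> dual_quadric c"
  shows "x = 0"
proof -
  define U V where "U = (x$1)\<^sup>2 + (x$2)\<^sup>2" and "V = (x$3)\<^sup>2 + (x$4)\<^sup>2"
  have eqs: "c\<^sup>2 * U = V" "U = c\<^sup>2 * V"
    using assms(3,4) by (auto simp: quadric_def dual_quadric_def U_def V_def)
  have "(1 - c\<^sup>2) * (1 + c\<^sup>2) * U = U - c\<^sup>2 * (c\<^sup>2 * U)"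
    by algebra
  also have "\<dots> = 0"
    using eqs(2) unfolding eqs(1) by simp
  finally have "(1 - c\<^sup>2) * (1 + c\<^sup>2) * U = 0" .
  moreover have "1 - c\<^sup>2 \<noteq> 0"
    using assms(1,2) by (auto simp: power2_eq_1_iff)
  moreover have "1 + c\<^sup>2 \<noteq> 0"
    by (metis add_pos_nonneg less_irrefl zero_le_power2 zero_less_one)
  ultimately have "U = 0" "V = 0"
    using eqs by auto
  then show ?thesis
    by (simp add: U_def V_def sum_power2_eq_zero_iff vec_eq_iff forall_4)
qed

lemma A_set_Int_B_set:
  assumes "c_param p q a b > 0" "c_param p q a b \<noteq> 1"
    and "A_set p q a b \<subseteq> rays_on (quadric (c_param p q a b))"
    and "B_set p q a b \<subseteq> rays_on (dual_quadric (c_param p q a b))"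
  shows "A_set p q a b \<inter> B_set p q a b = {}"
proof (rule equals0I)
  fix L assume "L \<in> A_set p q a b \<inter> B_set p q a b"
  then have L: "is_ray L" "L \<subseteq> quadric (c_param p q a b)" "L \<subseteq> dual_quadric (c_param p q a b)"
    using assms(3,4) by (auto simp: rays_on_def)
  then have "L \<subseteq> {0}"
    using quadric_Int_dual_quadric[OF assms(1,2)] by blast
  then have "dim L = 0"
    by (metis dim_eq_0)
  with L(1) show False
    by (simp add: is_ray_def)
qed


section \<open>The orthogonal equivalence\<close>

text \<open>Writing the 2-by-2 matrix as z -> w z + w' conj(z), the new coordinates are sqrt 2 times
  the real and imaginary parts of w and of w'. The division by sqrt 2 makes the map
  orthogonal.\<close>

definition conformal_split :: "real^4^4" where
  "conformal_split = (\<chi> i j. (vector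
     [vector [1, 0, 0, 1], vector [0, - 1, 1, 0],
      vector [1, 0, 0, - 1], vector [0, 1, 1, 0]] :: real^4^4) $ i $ j / sqrt 2)"

lemma conformal_split_nth:
  "(conformal_split *v x) $ 1 = (x$1 + x$4) / sqrt 2"
  "(conformal_split *v x) $ 2 = (x$3 - x$2) / sqrt 2"
  "(conformal_split *v x) $ 3 = (x$1 - x$4) / sqrt 2"
  "(conformal_split *v x) $ 4 = (x$2 + x$3) / sqrt 2"
  by (simp_all add: conformal_split_def matrix_vector_mult_def sum_4 field_simps)

lemma orthogonal_conformal_split: "orthogonal_matrix conformal_split"
  unfolding orthogonal_matrix
  by (simp add: vec_eq_iff forall_4 conformal_split_def transpose_def matrix_matrix_mult_def sum_4
      mat_def)

lemma EL_matrix_nth: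
  fixes p q :: nat and a b :: int
  defines "\<alpha> \<equiv> step_angle p a" and "\<beta> \<equiv> step_angle q b"
  shows "(EL_matrix p q a b *v x) $ 1
           = cos \<alpha> * cos \<beta> * x$1 - cos \<alpha> * sin \<beta> * x$2 - sin \<alpha> * cos \<beta> * x$3 + sin \<alpha> * sin \<beta> * x$4"
    and "(EL_matrix p q a b *v x) $ 2
           = cos \<alpha> * sin \<beta> * x$1 + cos \<alpha> * cos \<beta> * x$2 - sin \<alpha> * sin \<beta> * x$3 - sin \<alpha> * cos \<beta> * x$4"
    and "(EL_matrix p q a b *v x) $ 3
           = sin \<alpha> * cos \<beta> * x$1 - sin \<alpha> * sin \<beta> * x$2 + cos \<alpha> * cos \<beta> * x$3 - cos \<alpha> * sin \<beta> * x$4"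
    and "(EL_matrix p q a b *v x) $ 4
           = sin \<alpha> * sin \<beta> * x$1 + sin \<alpha> * cos \<beta> * x$2 + cos \<alpha> * sin \<beta> * x$3 + cos \<alpha> * cos \<beta> * x$4"
  by (simp_all add: EL_matrix_def kronecker_def matrix_vector_mult_def sum_4 kron_fst_def kron_snd_def
      rot_def \<alpha>_def \<beta>_def)

text \<open>Conjugation by the two rotations multiplies w by exp(i(\<alpha>-\<beta>)) and w' by
  exp(i(\<alpha>+\<beta>)). The scalar \<open>k\<close> leaves room for the common factor sqrt 2 of
  the two starting vectors.\<close>

lemma conformal_split_EL_matrix:
  assumes "conformal_split *v x = k *\<^sub>R torus_vec s s' \<phi> \<psi>"
  shows "conformal_split *v (EL_matrix p q a b *v x) =
    k *\<^sub>R torus_vec s s' (\<phi> + (step_angle p a - step_angle q b)) (\<psi> + (step_angle p a + step_angle q b))"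
proof -
  have "(x$1 + x$4) / sqrt 2 = k * (s * cos \<phi>)" "(x$3 - x$2) / sqrt 2 = k * (s * sin \<phi>)"
    "(x$1 - x$4) / sqrt 2 = k * (s' * cos \<psi>)" "(x$2 + x$3) / sqrt 2 = k * (s' * sin \<psi>)"
    using arg_cong[OF assms, of "\<lambda>v. v $ 1"] arg_cong[OF assms, of "\<lambda>v. v $ 2"]
      arg_cong[OF assms, of "\<lambda>v. v $ 3"] arg_cong[OF assms, of "\<lambda>v. v $ 4"]
    by (simp_all add: conformal_split_nth)
  then have eqs: "x$1 + x$4 = sqrt 2 * k * (s * cos \<phi>)" "x$3 - x$2 = sqrt 2 * k * (s * sin \<phi>)"
    "x$1 - x$4 = sqrt 2 * k * (s' * cos \<psi>)" "x$2 + x$3 = sqrt 2 * k * (s' * sin \<psi>)"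
    by (simp_all add: field_simps)
  \<comment> \<open>Clearing the denominator leaves polynomial identities for
    \<open>algebra\<close>.\<close>
  have div_eq: "u / sqrt 2 = w \<longleftrightarrow> u = sqrt 2 * w" for u w
    by (auto simp: field_simps)
  show ?thesis
    unfolding vec_eq_iff forall_4 conformal_split_nth EL_matrix_nth vector_scaleR_component torus_vec_nth
      real_scaleR_def cos_add sin_add cos_diff sin_diff div_eq
    using eqs by (intro conjI; algebra)
qed

lemma conformal_split_EL_pow:
  assumes "conformal_split *v x = k *\<^sub>R torus_vec s s' \<phi> \<psi>"
  shows "conformal_split *v (((\<lambda>x. EL_matrix p q a b *v x) ^^ n) x) =
    k *\<^sub>R torus_vec s s' (\<phi> + of_nat n * (step_angle p a - step_angle q b))
      (\<psi> + of_nat n * (step_angle p a + step_angle q b))"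
proof (induction n)
  case (Suc n)
  then show ?case
    using conformal_split_EL_matrix[OF Suc, of p q a b] by (simp add: algebra_simps)
qed (use assms in simp)

text \<open>The angles (-\<beta>, \<beta>) belong to the grid index (0, 1). This is the source of
  the offset t + 1 in the second index of A; the other orbit starts at (0, 0).\<close>

lemma conformal_split_EL_a:
  "conformal_split *v EL_a p q a b =
    sqrt 2 *\<^sub>R torus_vec 1 (- c_param p q a b) (- step_angle q b) (step_angle q b)"
  by (simp add: vec_eq_iff forall_4 conformal_split_nth EL_a_def Let_def field_simps)

lemma conformal_split_EL_b:
  "conformal_split *v EL_b p q a b = sqrt 2 *\<^sub>R torus_vec (c_param p q a b) 1 0 0"
  by (simp add: vec_eq_iff forall_4 conformal_split_nth EL_b_def Let_def field_simps)

lemma image_EL_rays: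
  assumes "p > 0" "q > 0"
  shows image_EL_a_ray: "(\<lambda>x. conformal_split *v x) ` EL_a_ray p q a b t = A_ray p q a b t (t + 1)"
    and image_EL_b_ray: "(\<lambda>x. conformal_split *v x) ` EL_b_ray p q a b t = B_ray p q a b t t"
proof -
  \<comment> \<open>\<open>EL_pow\<close> iterates by the representative of t modulo pq; passing
    back to t is harmless since the two agree modulo p and modulo q.\<close>
  define n where "n = nat (t mod int (p * q))"
  have "int n = t mod int (p * q)"
    using assms by (simp add: n_def)
  then have cong: "[int n = t] (mod int p)" "[int n = t] (mod int q)"
    by (simp_all add: mod_mult_cong_right mod_mult_cong_left)
  have "(\<lambda>x. conformal_split *v x) ` EL_a_ray p q a b t = A_ray p q a b (int n) (int n + 1)"
    unfolding EL_a_ray_def image_ray EL_pow_def n_def[symmetric]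
      conformal_split_EL_pow[OF conformal_split_EL_a] A_ray_eq
    by (simp add: ray_scaleR algebra_simps)
  also have "\<dots> = A_ray p q a b t (t + 1)"
    using assms cong by (intro A_ray_cong cong_add) auto
  finally show "(\<lambda>x. conformal_split *v x) ` EL_a_ray p q a b t = A_ray p q a b t (t + 1)" .
  have "(\<lambda>x. conformal_split *v x) ` EL_b_ray p q a b t = B_ray p q a b (int n) (int n)"
    unfolding EL_b_ray_def image_ray EL_pow_def n_def[symmetric]
      conformal_split_EL_pow[OF conformal_split_EL_b] B_ray_eq
    by (simp add: ray_scaleR algebra_simps)
  also have "\<dots> = B_ray p q a b t t"
    using assms cong by (intro B_ray_cong) auto
  finally show "(\<lambda>x. conformal_split *v x) ` EL_b_ray p q a b t = B_ray p q a b t t" .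
qed

text \<open>Modulo (p, q), subtracting r on the diagonal is the index step (-1, +1). So
  \<open>t - r\<close> lands on B at (t - 1, t + 1), the fourth member of the context at (t, t +
  1).\<close>

lemma ray_image_EL_basis:
  assumes "p > 0" "q > 0" "[r = 1] (mod int p)" "[r = - 1] (mod int q)"
  shows "ray_image conformal_split (EL_basis p q a b r t) = context_C p q a b t (t + 1)"
proof -
  have "[t - r = t - 1] (mod int p)" "[t - r = t - - 1] (mod int q)"
    using cong_diff[OF cong_refl assms(3)] cong_diff[OF cong_refl assms(4)] by blast+
  then have "B_ray p q a b (t - r) (t - r) = B_ray p q a b (t - 1) (t + 1)"
    using assms(1,2) by (intro B_ray_cong) auto
  then show ?thesis
    using assms(1,2)
    by (simp add: ray_image_def EL_basis_def context_C_def image_EL_a_ray image_EL_b_ray)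
qed

text \<open>Orthogonality is pulled back from the context by the transpose, which inverts the
  equivalence.\<close>

lemma orthogonal_EL_basis:
  assumes "p > 0" "q > 0" "[r = 1] (mod int p)" "[r = - 1] (mod int q)" "admissible p q a b"
  shows "orthogonal_ray_basis (EL_basis p q a b r t)"
proof -
  let ?P = conformal_split
  have "ray_image (transpose ?P) (ray_image ?P S) = S" for S
    using orthogonal_conformal_split
    unfolding ray_image_def image_image matrix_vector_mul_assoc by (simp add: orthogonal_matrix_def)
  then show ?thesis
    using orthogonal_ray_basis_image[of "transpose ?P" "ray_image ?P (EL_basis p q a b r t)"]
      ray_image_EL_basis[OF assms(1-4)] orthogonal_context_C[OF assms(5)] orthogonal_conformal_split
    by (metis orthogonal_matrix_transpose)
qed

text \<open>Injectivity is uniqueness in the Chinese remainder theorem; surjectivity follows by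
  counting. The offsets k and l allow for the different starting points of the two orbits.\<close>

lemma bij_betw_CRT:
  assumes "p > 0" "q > 0" "coprime p q"
  shows "bij_betw (\<lambda>t. ((t + k) mod int p, (t + l) mod int q)) {0..<int (p * q)} (index_grid p q)"
    (is "bij_betw ?f ?T ?G")
proof -
  have inj: "inj_on ?f ?T"
  proof (rule inj_onI)
    fix t u assume tu: "t \<in> ?T" "u \<in> ?T" "?f t = ?f u"
    then have "[t + k = u + k] (mod int p)" "[t + l = u + l] (mod int q)"
      by (auto simp: cong_def)
    then have "[t = u] (mod int p * int q)"
      using assms(3) by (intro coprime_cong_mult) (auto simp: cong_add_rcancel)
    then show "t = u"
      using tu(1,2) cong_less_imp_eq_int[of t "int p * int q" u] by simp
  qed
  moreover have "?f ` ?T = ?G"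
  proof (rule card_subset_eq)
    show "?f ` ?T \<subseteq> ?G" "finite ?G"
      using assms(1,2) by (auto simp: index_grid_def)
    show "card (?f ` ?T) = card ?G"
      using card_image[OF inj] by (simp add: index_grid_def card_cartesian_product del: of_nat_mult)
  qed
  ultimately show ?thesis
    by (simp add: bij_betw_def)
qed

theorem proposition4p1:
  fixes p q :: nat and a b r :: int
  assumes "p \<ge> 3" and "q \<ge> 3" and "odd p" and "odd q" and "coprime p q"
    and "admissible p q a b"
    and "[r = 1] (mod int p)" and "[r = - 1] (mod int q)"
  shows "\<exists>P \<sigma> \<rho> \<tau>.
     orthogonally_equivalent_by P (EL_configuration p q a b) (dual_grid p q a b) \<and>
     A_set p q a b \<inter> B_set p q a b = {} \<and>
     ray_image P (EL_a_orbit p q a b) = A_set p q a b \<and>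
     A_set p q a b \<subseteq> rays_on (quadric (c_param p q a b)) \<and>
     is_grid p q (quadric (c_param p q a b)) (A_set p q a b) \<and>
     ray_image P (EL_b_orbit p q a b) = B_set p q a b \<and>
     B_set p q a b \<subseteq> rays_on (dual_quadric (c_param p q a b)) \<and>
     is_grid p q (dual_quadric (c_param p q a b)) (B_set p q a b) \<and>
     bij_betw \<sigma> {0..<int (p * q)} (index_grid p q) \<and>
     bij_betw \<rho> {0..<int (p * q)} (index_grid p q) \<and>
     bij_betw \<tau> {0..<int (p * q)} (index_grid p q) \<and>
     (\<forall>t\<in>{0..<int (p * q)}.
        (\<lambda>x. P *v x) ` EL_a_ray p q a b t = A_ray p q a b (fst (\<sigma> t)) (snd (\<sigma> t)) \<and>
        (\<lambda>x. P *v x) ` EL_b_ray p q a b t = B_ray p q a b (fst (\<rho> t)) (snd (\<rho> t)) \<and>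
        orthogonal_ray_basis (EL_basis p q a b r t) \<and>
        ray_image P (EL_basis p q a b r t) = context_C p q a b (fst (\<tau> t)) (snd (\<tau> t)))"
proof -
  let ?P = conformal_split and ?T = "{0..<int (p * q)}" and ?c = "c_param p q a b"
  \<comment> \<open>This map indexes the rays of the first orbit and also the contexts, so it is the
    witness for \<tau> as well. The \<open>+ 0\<close> matches the form of
    \<open>bij_betw_CRT\<close>.\<close>
  define \<sigma> where "\<sigma> t = ((t + 0) mod int p, (t + 1) mod int q)" for t
  define \<rho> where "\<rho> t = ((t + 0) mod int p, (t + 0) mod int q)" for t
  have pos: "p > 0" "q > 0"
    using assms(1,2) by auto
  have bij: "bij_betw \<sigma> ?T (index_grid p q)" "bij_betw \<rho> ?T (index_grid p q)"
    unfolding \<sigma>_def \<rho>_def using bij_betw_CRT pos assms(5) by blast+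
  have a_ray: "(\<lambda>x. ?P *v x) ` EL_a_ray p q a b t = A_ray p q a b (fst (\<sigma> t)) (snd (\<sigma> t))" for t
    unfolding image_EL_a_ray[OF pos] \<sigma>_def by (intro A_ray_cong pos) (simp_all add: cong_def)
  have b_ray: "(\<lambda>x. ?P *v x) ` EL_b_ray p q a b t = B_ray p q a b (fst (\<rho> t)) (snd (\<rho> t))" for t
    unfolding image_EL_b_ray[OF pos] \<rho>_def by (intro B_ray_cong pos) (simp_all add: cong_def)
  have basis: "ray_image ?P (EL_basis p q a b r t) = context_C p q a b (fst (\<sigma> t)) (snd (\<sigma> t))" for t
    unfolding ray_image_EL_basis[OF pos assms(7,8)] \<sigma>_def
    by (intro context_C_cong pos) (simp_all add: cong_def)
  \<comment> \<open>Surjectivity of \<sigma> rewrites the index grid as the image of the exponents,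
    so the two sets agree ray by ray.\<close>
  have imA: "ray_image ?P (EL_a_orbit p q a b) = A_set p q a b"
    unfolding ray_image_def EL_a_orbit_def A_set_def bij_betw_imp_surj_on[OF bij(1), symmetric]
      image_image a_ray by (simp add: case_prod_beta)
  have imB: "ray_image ?P (EL_b_orbit p q a b) = B_set p q a b"
    unfolding ray_image_def EL_b_orbit_def B_set_def bij_betw_imp_surj_on[OF bij(2), symmetric]
      image_image b_ray by (simp add: case_prod_beta)
  have "ray_image ?P (EL_configuration p q a b) = dual_grid p q a b"
    using imA imB by (simp add: EL_configuration_def dual_grid_def ray_image_def image_Un)
  then have equiv: "orthogonally_equivalent_by ?P (EL_configuration p q a b) (dual_grid p q a b)"
    by (simp add: orthogonally_equivalent_by_def orthogonal_conformal_split)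
  note c = c_param_admissible[OF assms(6)]
  have "coprime a (int p)" "coprime b (int q)"
    using assms(6) by (simp_all add: admissible_def)
  then have inj: "inj_on (\<lambda>i. circ (2 * (of_int i * step_angle p a))) {0..<int p}"
    "inj_on (\<lambda>j. circ (2 * (of_int j * step_angle q b))) {0..<int q}"
    using inj_on_circ_step assms(3,4) by blast+
  have A_on: "A_set p q a b \<subseteq> rays_on (quadric ?c)"
    by (auto simp: A_set_def A_ray_eq quadric_eq intro!: torus_rays_on_quadric)
  have B_on: "B_set p q a b \<subseteq> rays_on (dual_quadric ?c)"
    using c(1) by (auto simp: B_set_def B_ray_eq dual_quadric_eq intro!: torus_rays_on_quadric)
  have A_grid: "is_grid p q (quadric ?c) (A_set p q a b)"
    unfolding A_set_def A_ray_eq quadric_eq using c(1) by (intro is_grid_torus pos inj) auto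
  have B_grid: "is_grid p q (dual_quadric ?c) (B_set p q a b)"
    unfolding B_set_def B_ray_eq dual_quadric_eq using c(1) by (intro is_grid_torus pos inj) auto
  show ?thesis
    by (intro exI[of _ ?P] exI[of _ \<sigma>] exI[of _ \<rho>] exI[of _ \<sigma>] conjI ballI equiv imA imB A_on B_on
        A_grid B_grid bij a_ray b_ray basis A_set_Int_B_set[OF c(1,2) A_on B_on]
        orthogonal_EL_basis[OF pos assms(7,8,6)])
qed

end
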